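(* For every non-negative integer $m$ there is $n_0=n_0(m)$ such that for all integers $n>n_0$: (1) $\binom{n-2}{m} < g_n(m,l) \le \sum_{j=0}^{m}\binom{n-2j-2}{m-j}$ for every integer $l$ with $m+2 \le l \le n-m-1$; and (2) $\binom{n-3}{m} < g_n(m,n-m) \le \sum_{j=0}^{m}\binom{n-2j-3}{m-j}$. Here, for $0\le m\le l\le n$, $g_n(m,l)$ is the smallest integer $k\ge 0$ such that there exists a cutset in $2^{[n]}$ containing exactly $k$ subsets of size $i$ for each $m\le i\le l$ and no subsets of any other size.
   Context: $[n]=\{1,\dots,n\}$ and $2^{[n]}$ is the set of all subsets of $[n]$ ordered by inclusion. A maximal chain in $2^{[n]}$ is a chain $A_0 \subset A_1 \subset \cdots \subset A_n$ with $|A_i|=i$. A cutset is a collection $\mathcal{C}\subseteq 2^{[n]}$ that meets every maximal chain.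
   Formalization: The two strict lower bounds are asserted only for m ≥ 1: for m = 0 they are false, since g_n(0,l) = 1 while both binomial coefficients equal 1; the upper bounds are kept for all m ≥ 0. *)

theory Defs
  imports Complex_Main
begin

definition max_chain :: "nat \<Rightarrow> nat set set \<Rightarrow> bool" where
  "max_chain n M \<longleftrightarrow>
     (\<exists>A :: nat \<Rightarrow> nat set.
        (\<forall>i\<le>n. A i \<subseteq> {1..n} \<and> card (A i) = i) \<and>
        (\<forall>i<n. A i \<subset> A (Suc i)) \<and>
        M = A ` {..n})"

definition cutset :: "nat \<Rightarrow> nat set set \<Rightarrow> bool" where
  "cutset n C \<longleftrightarrow> C \<subseteq> Pow {1..n} \<and> (\<forall>M. max_chain n M \<longrightarrow> C \<inter> M \<noteq> {})"

definition uniform_cutset :: "nat \<Rightarrow> nat \<Rightarrow> nat \<Rightarrow> nat \<Rightarrow> nat set set \<Rightarrow> bool" where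
  "uniform_cutset n m l k C \<longleftrightarrow>
     cutset n C \<and>
     (\<forall>i\<in>{m..l}. card {A \<in> C. card A = i} = k) \<and>
     (\<forall>A\<in>C. card A \<in> {m..l})"

definition g :: "nat \<Rightarrow> nat \<Rightarrow> nat \<Rightarrow> nat" where
  "g n m l = (LEAST k. \<exists>C. uniform_cutset n m l k C)"

text \<open>
  The minimum is attained for all \<open>m \<le> l \<le> n\<close>: by unimodality of the binomial coefficients,
  \<open>k = min (n choose m) (n choose l)\<close> is admissible, since then level \<open>m\<close> or level \<open>l\<close>
  is contained in the cutset.
\<close>

lemma uniform_cutset_exists:
  assumes "m \<le> l" "l \<le> n"
  shows "\<exists>k C. uniform_cutset n m l k C"
proof -
  define k where "k = min (n choose m) (n choose l)"
  have k_le: "k \<le> n choose i" if "i \<in> {m..l}" for i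
  proof (cases "2 * i \<le> n")
    case True
    then have "n choose m \<le> n choose i" using that by (intro binomial_mono) auto
    then show ?thesis unfolding k_def by linarith
  next
    case False
    then have "n choose l \<le> n choose i"
      using that assms by (intro binomial_antimono) auto
    then show ?thesis unfolding k_def by linarith
  qed
  have "\<exists>F. F \<subseteq> {B. B \<subseteq> {1..n} \<and> card B = i} \<and> card F = k" if "i \<in> {m..l}" for i
  proof -
    have "k \<le> card {B. B \<subseteq> {1..n} \<and> card B = i}"
      using k_le[OF that] n_subsets[of "{1..n}" i] by simp
    then obtain F where "F \<subseteq> {B. B \<subseteq> {1..n} \<and> card B = i}" "card F = k"
      by (rule obtain_subset_with_card_n)
    then show ?thesis by blast
  qed
  then have "\<forall>i\<in>{m..l}. \<exists>F. F \<subseteq> {B. B \<subseteq> {1..n} \<and> card B = i} \<and> card F = k" by blast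
  from bchoice[OF this] obtain F where
    "\<forall>i\<in>{m..l}. F i \<subseteq> {B. B \<subseteq> {1..n} \<and> card B = i} \<and> card (F i) = k" ..
  then have F: "F i \<subseteq> {B. B \<subseteq> {1..n} \<and> card B = i}" "card (F i) = k"
    if "i \<in> {m..l}" for i using that by blast+
  define C where "C = (\<Union>i\<in>{m..l}. F i)"
  have level: "{B \<in> C. card B = i} = F i" if "i \<in> {m..l}" for i
  proof
    show "{B \<in> C. card B = i} \<subseteq> F i"
    proof
      fix B assume "B \<in> {B \<in> C. card B = i}"
      then obtain j where j: "j \<in> {m..l}" "B \<in> F j" "card B = i" unfolding C_def by blast
      then have "card B = j" using F(1)[OF j(1)] by blast
      then show "B \<in> F i" using j by simp
    qed
    show "F i \<subseteq> {B \<in> C. card B = i}" using F(1)[OF that] that unfolding C_def by blast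
  qed
  obtain r where r: "r \<in> {m..l}" "k = n choose r"
  proof (cases "n choose m \<le> n choose l")
    case True
    then show ?thesis using that[of m] assms unfolding k_def by simp
  next
    case False
    then show ?thesis using that[of l] assms unfolding k_def by simp
  qed
  have full: "F r = {B. B \<subseteq> {1..n} \<and> card B = r}"
    using F[OF r(1)] r(2) n_subsets[of "{1..n}" r] by (intro card_subset_eq) auto
  have "C \<inter> M \<noteq> {}" if M: "max_chain n M" for M
  proof -
    obtain A where A: "\<forall>i\<le>n. A i \<subseteq> {1..n} \<and> card (A i) = i" "M = A ` {..n}"
      using M unfolding max_chain_def by blast
    have "r \<le> n" using r assms by auto
    then have "A r \<in> F r" "A r \<in> M" using A full by auto
    then show ?thesis using r unfolding C_def by blast
  qed
  moreover have "C \<subseteq> Pow {1..n}" using F(1) unfolding C_def by blast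
  ultimately have "cutset n C" unfolding cutset_def by blast
  moreover have "\<forall>B\<in>C. card B \<in> {m..l}"
  proof
    fix B assume "B \<in> C"
    then obtain j where j: "j \<in> {m..l}" "B \<in> F j" unfolding C_def by blast
    then have "card B = j" using F(1)[OF j(1)] by blast
    then show "card B \<in> {m..l}" using j by simp
  qed
  ultimately have "uniform_cutset n m l k C"
    unfolding uniform_cutset_def using level F(2) by simp
  then show ?thesis by blast
qed

lemma max_chain_exists: "\<exists>M. max_chain n M"
proof -
  have "{1..i} \<subset> {1..Suc i}" for i :: nat
    unfolding atLeastAtMostSuc_conv[of 1 i, simplified] by auto
  then have "(\<forall>i\<le>n. {1..i} \<subseteq> {1..n} \<and> card {1..i} = i) \<and> (\<forall>i<n. {1..i} \<subset> {1..Suc i})"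
    by simp
  then have "max_chain n ((\<lambda>i. {1..i}) ` {..n})"
    unfolding max_chain_def
    by (rule_tac x = "\<lambda>i. {1..i}" in exI) simp
  then show ?thesis ..
qed

text \<open>
  The case \<open>m = 0\<close> is degenerate: the value is \<open>1\<close>, and hence not strictly larger than
  \<open>(n - 2) choose 0\<close> or \<open>(n - 3) choose 0\<close>.
\<close>

lemma g_zero:
  assumes "l \<le> n"
  shows "g n 0 l = 1"
proof -
  have least: "\<exists>C. uniform_cutset n 0 l (g n 0 l) C"
    unfolding g_def
    using LeastI_ex[of "\<lambda>k. \<exists>C. uniform_cutset n 0 l k C"] uniform_cutset_exists[OF le0 assms] .
  then obtain C where C: "uniform_cutset n 0 l (g n 0 l) C" ..
  have sub: "C \<subseteq> Pow {1..n}" using C unfolding uniform_cutset_def cutset_def by blast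
  then have fin: "finite C" by (rule finite_subset) simp
  have "{A \<in> C. card A = 0} \<subseteq> {{}}"
  proof
    fix A assume "A \<in> {A \<in> C. card A = 0}"
    then have "A \<subseteq> {1..n}" "card A = 0" using sub by blast+
    then show "A \<in> {{}}" using finite_subset[of A "{1..n}"] by simp
  qed
  then have "card {A \<in> C. card A = 0} \<le> card {{} :: nat set}" by (intro card_mono) auto
  moreover have "card {A \<in> C. card A = 0} = g n 0 l"
    using C unfolding uniform_cutset_def by simp
  ultimately have "g n 0 l \<le> 1" by simp
  moreover have "g n 0 l \<noteq> 0"
  proof
    assume "g n 0 l = 0"
    then have lev: "\<forall>i\<in>{0..l}. card {A \<in> C. card A = i} = 0" "\<forall>A\<in>C. card A \<in> {0..l}"
      using C unfolding uniform_cutset_def by auto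
    have "C = {}"
    proof (rule equals0I)
      fix A assume "A \<in> C"
      then have "card {B \<in> C. card B = card A} = 0" using lev by blast
      moreover have "finite {B \<in> C. card B = card A}" using fin by simp
      ultimately have "{B \<in> C. card B = card A} = {}" by (simp only: card_0_eq)
      then show False using \<open>A \<in> C\<close> by blast
    qed
    then show False
      using C max_chain_exists[of n] unfolding uniform_cutset_def cutset_def by blast
  qed
  ultimately show ?thesis by linarith
qed

end

theory Submission
  imports Defs
begin

text \<open>
  Call a set blocked if every chain of sets from the empty set up to it, increasing by one element
  at a time, meets the cutset. A blocked \<open>(i + 1)\<close>-set lies in the cutset or has all its
  \<open>i\<close>-subsets blocked, so the Lovasz form of the Kruskal--Katona theorem bounds the number of
  blocked sets level by level. If the common level size is too small, then at a suitable level the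
  sets blocked from below and those blocked from above cannot cover everything, and a maximal chain
  escapes. In part (2) this happens at the middle level: with at most \<open>(n - 3) choose m\<close> sets per
  level, fewer than \<open>(n - 1) choose t\<close> of the \<open>t\<close>-sets are blocked from below, and symmetrically
  from above. In part (1) level \<open>m + 2\<close> works: from below at most a proportion of about
  \<open>1 - (m + 2) / n\<close> is blocked, from above at most about \<open>(m + 1) / n\<close>.

  For the upper bounds, fix two elements \<open>a\<close> and \<open>b\<close>. Three levels \<open>m\<close>, \<open>m + 1\<close>, \<open>m + 2\<close> suffice
  in part (1): take \<open>S\<close>, \<open>S \<union> {a}\<close>, \<open>S \<union> {a, b}\<close> for all \<open>m\<close>-sets \<open>S\<close> avoiding \<open>a\<close> and \<open>b\<close>; the
  chains missing these contain \<open>b\<close> but not \<open>a\<close> at all three levels, and are dealt with recursively.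
  In part (2) this construction on \<open>{2..n}\<close> forces \<open>1\<close> into the chain near the bottom, and its
  complementary family forces \<open>1\<close> out of the chain near the top.
\<close>

subsection \<open>Binomial coefficients with real upper argument\<close>

lemma gbinomial_pos_real:
  fixes x :: real
  assumes "real k < x + 1"
  shows "0 < x gchoose k"
  unfolding gbinomial_prod_rev using assms by (auto intro!: divide_pos_pos prod_pos)

text \<open>All factors \<open>x - i\<close> with \<open>i < k\<close> are nonnegative here, so the
  products compare factor by factor.\<close>

lemma gbinomial_mono_real:
  fixes x y :: real
  assumes "real k \<le> x + 1" "x \<le> y"
  shows "x gchoose k \<le> y gchoose k"
  unfolding gbinomial_prod_rev using assms
  by (auto intro!: divide_right_mono prod_mono)

text \<open>Raising the argument by \<open>e\<close> gains \<open>1 + e / x\<close> in the leading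
  factor alone, and the other factors do not decrease. This later converts newly added sets into a
  small increase of the argument.\<close>

lemma gbinomial_growth:
  fixes x e :: real
  assumes "real j \<le> x + 1" "0 < x" "0 \<le> e" "0 < j"
  shows "(1 + e / x) * (x gchoose j) \<le> (x + e) gchoose j"
proof -
  obtain i where j: "j = Suc i" using assms(4) by (cases j) auto
  have x: "x gchoose j = x / Suc i * ((x - 1) gchoose i)"
    using gbinomial_absorption[of i x] by (simp add: j field_simps)
  have y: "(x + e) gchoose j = (x + e) / Suc i * ((x + e - 1) gchoose i)"
    using gbinomial_absorption[of i "x + e"] by (simp add: j field_simps)
  have "(x - 1) gchoose i \<le> (x + e - 1) gchoose i"
    using assms by (intro gbinomial_mono_real) (auto simp: j)
  then have "(x + e) / Suc i * ((x - 1) gchoose i) \<le> (x + e) / Suc i * ((x + e - 1) gchoose i)"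
    using assms by (intro mult_left_mono) auto
  moreover have "(1 + e / x) * (x / Suc i * ((x - 1) gchoose i)) = (1 + e / x) * x / Suc i * ((x - 1) gchoose i)"
    by (simp only: times_divide_eq_right mult.assoc times_divide_eq_left)
  moreover have "(1 + e / x) * x = x + e"
    using \<open>0 < x\<close> by (simp add: distrib_right)
  ultimately show ?thesis unfolding x y by (simp only:)
qed

subsection \<open>Lovasz form of the Kruskal--Katona theorem\<close>

text \<open>Kruskal--Katona read upwards: these sets have their whole shadow in \<open>U\<close>, so
  an upper bound on their number replaces a lower bound on a shadow.\<close>

definition cliques :: "nat \<Rightarrow> 'a set set \<Rightarrow> 'a set set" where
  "cliques r U = {X. finite X \<and> card X = Suc r \<and> (\<forall>v\<in>X. X - {v} \<in> U)}"

text \<open>A clique has at least two elements, so each survives the removal of another. For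
  \<open>r = 0\<close> and \<open>{} \<in> U\<close> every singleton would be a clique.\<close>

lemma cliques_subset_Pow:
  assumes "0 < r"
  shows "cliques r U \<subseteq> Pow (\<Union>U)"
proof
  fix X assume X: "X \<in> cliques r U"
  have "x \<in> \<Union>U" if "x \<in> X" for x
  proof -
    have "card X > 1" using X assms by (simp add: cliques_def)
    then obtain y where "y \<in> X" "y \<noteq> x"
      by (metis One_nat_def card_le_Suc0_iff_eq card.infinite linorder_not_less not_less_zero that)
    then have "X - {y} \<in> U" "x \<in> X - {y}" using X that by (auto simp: cliques_def)
    then show ?thesis by blast
  qed
  then show "X \<in> Pow (\<Union>U)" by blast
qed

lemma finite_cliques:
  assumes "0 < r" "finite U" "\<And>Y. Y \<in> U \<Longrightarrow> finite Y"
  shows "finite (cliques r U)"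
  by (rule finite_subset[OF cliques_subset_Pow[OF assms(1)]]) (use assms in auto)

lemma sum_card_members:
  assumes "finite V" "finite F" "\<And>X. X \<in> F \<Longrightarrow> X \<subseteq> V \<and> card X = k"
  shows "(\<Sum>v\<in>V. card {X \<in> F. v \<in> X}) = k * card F"
proof -
  have "(\<Sum>v\<in>V. card {X \<in> F. v \<in> X}) = (\<Sum>v\<in>V. \<Sum>X\<in>F. if v \<in> X then 1 else 0)"
    using assms(2) by (simp add: sum.If_cases Int_def)
  also have "\<dots> = (\<Sum>X\<in>F. \<Sum>v\<in>V. if v \<in> X then 1 else 0)" by (rule sum.swap)
  also have "\<dots> = (\<Sum>X\<in>F. k)"
  proof (rule sum.cong)
    fix X assume "X \<in> F"
    then have "V \<inter> X = X" "card X = k" using assms(3) by blast+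
    then show "(\<Sum>v\<in>V. if v \<in> X then 1 else 0) = k"
      using assms(1) by (simp add: sum.If_cases)
  qed simp
  finally show ?thesis by simp
qed

text \<open>
  Keevash's argument: it suffices to bound, for each vertex \<open>v\<close>, the number of cliques at \<open>v\<close> by
  \<open>(x - r) / r\<close> times the degree of \<open>v\<close>. For large degree, count the members of \<open>U\<close> avoiding \<open>v\<close>;
  for small degree, apply induction to the link of \<open>v\<close>.
\<close>
lemma card_cliques_le:
  fixes x :: real
  assumes "0 < r" "finite U" "\<And>Y. Y \<in> U \<Longrightarrow> finite Y \<and> card Y = r"
    and "real r \<le> x" "real (card U) \<le> x gchoose r"
  shows "real (Suc r) * card (cliques r U) \<le> (x - r) * card U"
  using assms
proof (induction r arbitrary: x U)
  case 0
  then show ?case by simp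
next
  case (Suc s)
  let ?r = "Suc s"
  define V where "V = \<Union>U"
  define d where "d v = card {Y \<in> U. v \<in> Y}" for v
  define K where "K v = {X \<in> cliques ?r U. v \<in> X}" for v
  have finV: "finite V" unfolding V_def using Suc.prems by auto
  have finK: "finite (cliques ?r U)" using Suc.prems by (intro finite_cliques) auto
  have inj: "inj_on (\<lambda>X. X - {v}) {X. v \<in> X}" for v :: 'a
    by (auto simp: inj_on_def)
  have x_pos: "0 < x" using Suc.prems by simp
  have vertex: "real ?r * card (K v) \<le> (x - ?r) * d v" if "v \<in> V" for v
  proof (cases "real ?r * card U \<le> x * d v")
    case True
    \<comment> \<open>Large degree: deleting \<open>v\<close> maps the cliques at \<open>v\<close>
      injectively into the members of \<open>U\<close> that avoid \<open>v\<close>.\<close>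
    have "card (K v) = card ((\<lambda>X. X - {v}) ` K v)"
      by (rule card_image[symmetric]) (rule inj_on_subset[OF inj], auto simp: K_def)
    also have "\<dots> \<le> card (U - {Y \<in> U. v \<in> Y})"
      using Suc.prems by (intro card_mono) (auto simp: K_def cliques_def)
    also have "\<dots> = card U - d v"
      unfolding d_def using Suc.prems by (intro card_Diff_subset) auto
    finally have "card (K v) \<le> card U - d v" .
    moreover have "d v \<le> card U" unfolding d_def using Suc.prems by (intro card_mono) auto
    ultimately have "real (card (K v)) \<le> real (card U) - d v" by linarith
    then have "real ?r * card (K v) \<le> real ?r * (real (card U) - d v)"
      by (intro mult_left_mono) auto
    also have "\<dots> \<le> (x - ?r) * d v" using True by (simp add: algebra_simps)
    finally show ?thesis .
  next
    case False
    define L where "L = (\<lambda>Y. Y - {v}) ` {Y \<in> U. v \<in> Y}"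
    have cardL: "card L = d v"
      unfolding L_def d_def by (rule card_image) (rule inj_on_subset[OF inj], auto)
    \<comment> \<open>Small degree: by absorption the link of \<open>v\<close> has fewer than
      \<open>(x - 1) gchoose s\<close> members, so induction applies with
      \<open>x - 1\<close>.\<close>
    have "x * d v < real ?r * (x gchoose ?r)"
      using False Suc.prems(5) mult_left_mono[OF Suc.prems(5), of "real ?r"] by linarith
    also have "\<dots> = x * ((x - 1) gchoose s)" by (rule gbinomial_absorption)
    finally have dv: "real (d v) < (x - 1) gchoose s" using x_pos by simp
    show ?thesis
    \<comment> \<open>The induction hypothesis requires \<open>0 < s\<close>. For
      \<open>s = 0\<close> the degree would be below 1, yet \<open>v\<close> lies in some member of
      \<open>U\<close>.\<close>
    proof (cases "s = 0")
      case True
      then have "d v = 0" using dv by simp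
      moreover have "0 < d v"
        unfolding d_def card_gt_0_iff using that Suc.prems by (auto simp: V_def)
      ultimately show ?thesis by simp
    next
      case False
      have L: "finite Y \<and> card Y = s" if "Y \<in> L" for Y
        using that Suc.prems by (auto simp: L_def)
      have finL: "finite L" unfolding L_def using Suc.prems by simp
      have "real (Suc s) * card (cliques s L) \<le> (x - 1 - s) * card L"
        using False finL L dv cardL Suc.prems by (intro Suc.IH) auto
      moreover have "card (K v) \<le> card (cliques s L)"
      proof -
        have "(\<lambda>X. X - {v}) ` K v \<subseteq> cliques s L"
        proof
          fix Z assume "Z \<in> (\<lambda>X. X - {v}) ` K v"
          then obtain X where X: "Z = X - {v}" "v \<in> X" "X \<in> cliques ?r U"
            by (auto simp: K_def)
          have "Z - {w} \<in> L" if "w \<in> Z" for w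
          proof -
            have "X - {w} \<in> U" "v \<in> X - {w}" "Z - {w} = X - {w} - {v}"
              using that X by (auto simp: cliques_def)
            then show ?thesis unfolding L_def by blast
          qed
          then show "Z \<in> cliques s L" using X by (auto simp: cliques_def)
        qed
        then have "card ((\<lambda>X. X - {v}) ` K v) \<le> card (cliques s L)"
          using False finL L by (intro card_mono finite_cliques) auto
        moreover have "card ((\<lambda>X. X - {v}) ` K v) = card (K v)"
          by (rule card_image) (rule inj_on_subset[OF inj], auto simp: K_def)
        ultimately show ?thesis by simp
      qed
      then have "real (Suc s) * card (K v) \<le> real (Suc s) * card (cliques s L)"
        by (intro mult_left_mono) auto
      ultimately show ?thesis using cardL by (simp add: algebra_simps)
    qed
  qed
  \<comment> \<open>Summing over \<open>v\<close> counts each clique \<open>?r + 1\<close> times and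
    each member of \<open>U\<close> \<open>?r\<close> times.\<close>
  have "real (Suc ?r) * card (cliques ?r U) = (\<Sum>v\<in>V. real (card (K v)))"
  proof -
    have "(\<Sum>v\<in>V. card (K v)) = Suc ?r * card (cliques ?r U)"
      unfolding K_def
      by (rule sum_card_members[OF finV finK])
        (use cliques_subset_Pow[of ?r U] in \<open>auto simp: V_def cliques_def\<close>)
    then show ?thesis by (metis of_nat_mult of_nat_sum)
  qed
  moreover have "(\<Sum>v\<in>V. real (d v)) = real ?r * card U"
  proof -
    have "(\<Sum>v\<in>V. d v) = ?r * card U"
      unfolding d_def by (rule sum_card_members[OF finV]) (use Suc.prems in \<open>auto simp: V_def\<close>)
    then show ?thesis by (metis of_nat_mult of_nat_sum)
  qed
  moreover have "real ?r * (\<Sum>v\<in>V. real (card (K v))) \<le> (x - ?r) * (\<Sum>v\<in>V. real (d v))"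
    unfolding sum_distrib_left using vertex by (rule sum_mono)
  ultimately have "real ?r * (real (Suc ?r) * card (cliques ?r U)) \<le> real ?r * ((x - ?r) * card U)"
    by (simp add: algebra_simps)
  then show ?case by (rule mult_left_le_imp_le) simp
qed

lemma card_cliques_le_gbinomial:
  fixes x :: real
  assumes "0 < r" "finite U" "\<And>Y. Y \<in> U \<Longrightarrow> finite Y \<and> card Y = r"
    and "real r \<le> x" "real (card U) \<le> x gchoose r"
  shows "real (card (cliques r U)) \<le> x gchoose Suc r"
proof -
  have "real (Suc r) * card (cliques r U) \<le> (x - r) * card U"
    by (rule card_cliques_le[OF assms])
  also have "\<dots> \<le> (x - r) * (x gchoose r)" using assms by (intro mult_left_mono) auto
  also have "\<dots> = real (Suc r) * (x gchoose Suc r)"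
    using gbinomial_mult_1[of x r] by (simp add: algebra_simps)
  finally show ?thesis by (rule mult_left_le_imp_le) simp
qed

subsection \<open>Blocked sets\<close>

text \<open>Graded by size, so that it can be counted level by level: the last step of a chain to
  \<open>X\<close> comes from some \<open>X - {v}\<close>, hence outside \<open>C\<close> all of
  these must be blocked.\<close>

primrec blocked :: "'a set \<Rightarrow> 'a set set \<Rightarrow> nat \<Rightarrow> 'a set set" where
  "blocked V C 0 = C \<inter> {{}}"
| "blocked V C (Suc i) =
     {X \<in> Pow V. card X = Suc i \<and> (X \<in> C \<or> (\<forall>v\<in>X. X - {v} \<in> blocked V C i))}"

lemma blocked_subset:
  assumes "X \<in> blocked V C i"
  shows "X \<subseteq> V \<and> card X = i"
  using assms by (cases i) auto

lemma finite_blocked: "finite V \<Longrightarrow> finite (blocked V C i)"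
  by (rule finite_subset[of _ "Pow V"]) (auto dest: blocked_subset)

lemma card_blocked_Suc_le:
  assumes "finite V" "finite C" "0 < i"
  shows "card (blocked V C (Suc i)) \<le> card {X \<in> C. card X = Suc i} + card (cliques i (blocked V C i))"
proof -
  have "blocked V C (Suc i) \<subseteq> {X \<in> C. card X = Suc i} \<union> cliques i (blocked V C i)"
    using finite_subset[OF _ assms(1)] by (auto simp: cliques_def)
  moreover have "finite (cliques i (blocked V C i))"
    using assms finite_blocked[OF assms(1)] finite_subset[OF _ assms(1)]
    by (intro finite_cliques) (auto dest!: blocked_subset)
  ultimately have "card (blocked V C (Suc i)) \<le> card ({X \<in> C. card X = Suc i} \<union> cliques i (blocked V C i))"
    using assms by (intro card_mono) auto
  also have "\<dots> \<le> card {X \<in> C. card X = Suc i} + card (cliques i (blocked V C i))"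
    by (rule card_Un_le)
  finally show ?thesis .
qed

lemma blocked_below:
  assumes "\<And>X. X \<in> C \<Longrightarrow> m \<le> card X" "i < m"
  shows "blocked V C i = {}"
  using assms(2)
proof (induction i)
  case 0
  then show ?case using assms(1) by fastforce
next
  case (Suc i)
  then show ?case using assms(1) by fastforce
qed

text \<open>Nothing is blocked below \<open>m\<close>, so the second alternative could hold only
  vacuously, and a set of positive size has an element to remove.\<close>

lemma blocked_first:
  assumes "\<And>X. X \<in> C \<Longrightarrow> m \<le> card X"
  shows "blocked V C m \<subseteq> {X \<in> C. card X = m}"
proof (cases m)
  case (Suc j)
  then have "blocked V C j = {}" using assms by (intro blocked_below[of _ m]) auto
  moreover have "X \<noteq> {}" if "card X = Suc j" for X :: "'a set" using that by auto
  ultimately show ?thesis using Suc by auto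
qed auto

text \<open>An unblocked set lies outside \<open>C\<close> and, if nonempty, has an unblocked
  predecessor \<open>X - {v}\<close>; descending to the empty set yields the chain.\<close>

lemma unblocked_chain:
  assumes "finite V" "X \<subseteq> V" "card X = i" "X \<notin> blocked V C i"
  shows "\<exists>A. A i = X \<and> (\<forall>j\<le>i. A j \<subseteq> V \<and> card (A j) = j \<and> A j \<notin> C) \<and>
    (\<forall>j<i. A j \<subset> A (Suc j))"
  using assms(2-)
proof (induction i arbitrary: X)
  case 0
  then have "X = {}" using finite_subset[OF _ assms(1)] by auto
  then show ?case using 0 by (intro exI[of _ "\<lambda>_. {}"]) auto
next
  case (Suc i)
  then obtain v where v: "v \<in> X" "X - {v} \<notin> blocked V C i" "X \<notin> C" by auto
  have fin: "finite X" using Suc.prems assms(1) by (meson finite_subset)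
  have "X - {v} \<subseteq> V" "card (X - {v}) = i" using Suc.prems v fin by auto
  from Suc.IH[OF this v(2)] obtain A where A: "A i = X - {v}"
    "\<forall>j\<le>i. A j \<subseteq> V \<and> card (A j) = j \<and> A j \<notin> C" "\<forall>j<i. A j \<subset> A (Suc j)" by blast
  show ?case
    by (rule exI[of _ "A(Suc i := X)"]) (use A v Suc.prems in \<open>auto simp: le_Suc_eq less_Suc_eq\<close>)
qed

text \<open>Otherwise a chain up to \<open>X\<close> and the complements of a chain up to
  \<open>{1..n} - X\<close> could be glued at \<open>X\<close> into a maximal chain missing
  \<open>C\<close>.\<close>

lemma cutset_blocked:
  assumes "cutset n C" "X \<subseteq> {1..n}" "card X = t"
  shows "X \<in> blocked {1..n} C t \<or>
    {1..n} - X \<in> blocked {1..n} ((\<lambda>Y. {1..n} - Y) ` C) (n - t)"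
proof (rule ccontr)
  define D where "D = (\<lambda>Y. {1..n} - Y) ` C"
  assume "\<not> ?thesis"
  then have no: "X \<notin> blocked {1..n} C t" "{1..n} - X \<notin> blocked {1..n} D (n - t)"
    by (auto simp: D_def)
  have t: "t \<le> n" using card_mono[OF _ assms(2)] assms(3) by simp
  have compl: "{1..n} - X \<subseteq> {1..n}" "card ({1..n} - X) = n - t"
    using assms(2,3) by (auto simp: card_Diff_subset finite_subset)
  obtain A where A: "A t = X" "\<forall>j\<le>t. A j \<subseteq> {1..n} \<and> card (A j) = j \<and> A j \<notin> C"
    "\<forall>j<t. A j \<subset> A (Suc j)"
    using unblocked_chain[OF _ assms(2,3) no(1)] by auto
  obtain B where B: "B (n - t) = {1..n} - X"
    "\<forall>j\<le>n-t. B j \<subseteq> {1..n} \<and> card (B j) = j \<and> B j \<notin> D"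
    "\<forall>j<n-t. B j \<subset> B (Suc j)"
    using unblocked_chain[OF _ compl no(2)] by auto
  define E where "E j = (if j \<le> t then A j else {1..n} - B (n - j))" for j
  \<comment> \<open>Both formulas for \<open>E\<close> agree at \<open>j = t\<close>, so the step
    from \<open>t\<close> to \<open>t + 1\<close> can use the second one.\<close>
  have Et: "E j = {1..n} - B (n - j)" if "t \<le> j" for j
    using that A(1) B(1) assms(2) by (cases "j = t") (auto simp: E_def)
  have E1: "E j \<subseteq> {1..n} \<and> card (E j) = j \<and> E j \<notin> C" if "j \<le> n" for j
  proof (cases "j \<le> t")
    case True
    then show ?thesis using A by (simp add: E_def)
  next
    case False
    have b: "B (n - j) \<subseteq> {1..n}" "card (B (n - j)) = n - j" "B (n - j) \<notin> D"
      using B(2) False by auto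
    have "B (n - j) = {1..n} - ({1..n} - B (n - j))" using b by blast
    then have "{1..n} - B (n - j) \<notin> C" using b(3) unfolding D_def by blast
    then show ?thesis
      using b that False by (auto simp: E_def card_Diff_subset finite_subset)
  qed
  have E2: "E j \<subset> E (Suc j)" if "j < n" for j
  proof (cases "j < t")
    case True
    then show ?thesis using A by (simp add: E_def)
  next
    case False
    then have "B (n - Suc j) \<subset> B (Suc (n - Suc j))" using B(3) that by auto
    moreover have "Suc (n - Suc j) = n - j" using that by simp
    moreover have "B (n - j) \<subseteq> {1..n}" using B(2) False by auto
    ultimately have "{1..n} - B (n - j) \<subset> {1..n} - B (n - Suc j)" by auto
    then show ?thesis using False Et by simp
  qed
  have "max_chain n (E ` {..n})" unfolding max_chain_def using E1 E2 by blast
  then have "C \<inter> E ` {..n} \<noteq> {}" using assms(1) by (auto simp: cutset_def)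
  then show False using E1 by auto
qed

text \<open>Both lower bounds contradict this inequality, each at its own level
  \<open>t\<close>.\<close>

lemma cutset_card_blocked:
  assumes "cutset n C" "t \<le> n"
  shows "n choose t \<le> card (blocked {1..n} C t) +
    card (blocked {1..n} ((\<lambda>Y. {1..n} - Y) ` C) (n - t))"
proof -
  let ?c = "\<lambda>Y. {1..n} - Y"
  let ?B = "blocked {1..n} (?c ` C) (n - t)"
  have "{X. X \<subseteq> {1..n} \<and> card X = t} \<subseteq> blocked {1..n} C t \<union> ?c ` ?B"
  proof
    fix X assume "X \<in> {X. X \<subseteq> {1..n} \<and> card X = t}"
    then have X: "X \<subseteq> {1..n}" "card X = t" by auto
    moreover have "X = ?c (?c X)" using X by blast
    ultimately show "X \<in> blocked {1..n} C t \<union> ?c ` ?B"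
      using cutset_blocked[OF assms(1) X] by blast
  qed
  then have "card {X. X \<subseteq> {1..n} \<and> card X = t} \<le> card (blocked {1..n} C t \<union> ?c ` ?B)"
    by (intro card_mono) (auto intro: finite_blocked)
  also have "\<dots> \<le> card (blocked {1..n} C t) + card (?c ` ?B)" by (rule card_Un_le)
  also have "\<dots> \<le> card (blocked {1..n} C t) + card ?B"
    by (simp add: card_image_le finite_blocked)
  finally show ?thesis using n_subsets[of "{1..n}" t] by simp
qed

text \<open>Kruskal--Katona carries the same argument \<open>x\<close> to the next level; only the
  members of \<open>C\<close> there are added.\<close>

lemma card_blocked_grow:
  fixes x :: real
  assumes "finite V" "finite C" "0 < i" "real i \<le> x" "card (blocked V C i) \<le> x gchoose i"
  shows "card (blocked V C (Suc i)) \<le> (x gchoose Suc i) + card {X \<in> C. card X = Suc i}"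
proof -
  have "card (cliques i (blocked V C i)) \<le> x gchoose Suc i"
    using assms finite_blocked[OF assms(1)] finite_subset[OF _ assms(1)]
    by (intro card_cliques_le_gbinomial) (auto dest!: blocked_subset)
  then show ?thesis
    using card_blocked_Suc_le[OF assms(1-3)] by linarith
qed

text \<open>Kruskal--Katona with \<open>x = card V\<close>: its ratio is that of consecutive
  binomial coefficients, so the proportion of blocked sets rises only by the contribution of
  \<open>C\<close>.\<close>

lemma card_blocked_density:
  assumes "finite V" "finite C" "0 < i" "i < card V"
  shows "card (blocked V C (Suc i)) / (card V choose Suc i)
    \<le> card (blocked V C i) / (card V choose i) + card {X \<in> C. card X = Suc i} / (card V choose Suc i)"
proof -
  let ?n = "card V" and ?U = "blocked V C i"
  have U: "?U \<subseteq> {X. X \<subseteq> V \<and> card X = i}" by (auto dest: blocked_subset)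
  have "card ?U \<le> ?n choose i"
    using card_mono[OF _ U] n_subsets[OF assms(1), of i] assms(1) by simp
  then have "real (Suc i) * card (cliques i ?U) \<le> (real ?n - i) * card ?U"
    using assms finite_blocked[OF assms(1)] finite_subset[OF _ assms(1)]
    by (intro card_cliques_le) (auto dest!: blocked_subset simp: binomial_gbinomial[symmetric])
  also have "(real ?n - i) * card ?U = (real ?n - i) * (?n choose i) * (card ?U / (?n choose i))"
    using assms by simp
  also have "(real ?n - i) * (?n choose i) = real (Suc i) * (?n choose Suc i)"
    using gbinomial_mult_1[of "real ?n" i] by (simp add: binomial_gbinomial algebra_simps)
  finally have "real (Suc i) * card (cliques i ?U)
      \<le> real (Suc i) * ((?n choose Suc i) * (card ?U / (?n choose i)))"
    by (simp only: mult.assoc)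
  then have "card (cliques i ?U) \<le> (?n choose Suc i) * (card ?U / (?n choose i))"
    by (rule mult_left_le_imp_le) simp
  then have "card (blocked V C (Suc i)) \<le>
      card {X \<in> C. card X = Suc i} + (?n choose Suc i) * (card ?U / (?n choose i))"
    using card_blocked_Suc_le[OF assms(1-3)] by linarith
  then have "card (blocked V C (Suc i)) / (?n choose Suc i) \<le>
      (card {X \<in> C. card X = Suc i} + (?n choose Suc i) * (card ?U / (?n choose i))) / (?n choose Suc i)"
    by (rule divide_right_mono) simp
  also have "\<dots> = card ?U / (?n choose i) + card {X \<in> C. card X = Suc i} / (?n choose Suc i)"
    using assms(4) by (simp add: add_divide_distrib)
  finally show ?thesis .
qed

subsection \<open>Lower bounds\<close>

lemma binomial_step_ge:
  fixes M a :: real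
  assumes "real (Suc k) \<le> M" "a \<le> real N - k" "0 \<le> a"
  shows "a / M * (N choose k) \<le> N choose Suc k"
proof -
  have "a * (N choose k) \<le> (real N - k) * (N choose k)"
    using assms by (intro mult_right_mono) auto
  also have "\<dots> = real (Suc k) * (N choose Suc k)"
    using gbinomial_mult_1[of "real N" k] by (simp add: binomial_gbinomial algebra_simps)
  also have "\<dots> \<le> M * (N choose Suc k)" using assms by (intro mult_right_mono) auto
  finally show ?thesis using assms by (simp add: field_simps)
qed

lemma binomial_Suc_step_ge:
  fixes M a :: real
  assumes "real (Suc k) \<le> M" "a \<le> real (Suc N)" "0 \<le> a"
  shows "a / M * (N choose k) \<le> Suc N choose Suc k"
proof -
  have "a * (N choose k) \<le> real (Suc N) * (N choose k)"
    using assms by (intro mult_right_mono) auto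
  also have "\<dots> = real (Suc k) * (Suc N choose Suc k)"
    by (metis Suc_times_binomial of_nat_mult)
  also have "\<dots> \<le> M * (Suc N choose Suc k)" using assms by (intro mult_right_mono) auto
  finally show ?thesis using assms by (simp add: field_simps)
qed

text \<open>Each step gains at least \<open>a / M\<close> with \<open>a = n / 2\<close> and
  \<open>M = m + 4\<close>. Two steps gain \<open>n^2 / (4 M^2) \<ge> 4 n\<close> and three gain
  \<open>n^3 / (8 M^3) \<ge> n^2\<close>, because \<open>16 M^3 \<le> n\<close>.\<close>

lemma binomial_large:
  fixes n m :: nat
  assumes "16 * (m + 4) ^ 3 \<le> n"
  shows "4 * real n * ((n - 3) choose m) \<le> (n - 2) choose (m + 2)"
    and "(real n)\<^sup>2 * ((n - 3) choose m) \<le> (n - 2) choose (m + 3)"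
    and "8 * (m + 4) \<le> n"
proof -
  define M where "M = real (m + 4)"
  have M: "4 \<le> M" by (simp add: M_def)
  have n: "16 * M ^ 3 \<le> n"
    unfolding M_def using assms by (metis of_nat_le_iff of_nat_mult of_nat_numeral of_nat_power)
  have M3: "M * 1 \<le> M * M\<^sup>2" "M\<^sup>2 * 1 \<le> M\<^sup>2 * M"
    using M by (intro mult_left_mono; simp)+
  then have n1: "16 * M \<le> n" and n2: "16 * M\<^sup>2 \<le> n"
    using n by (simp_all add: power2_eq_square power3_eq_cube)
  show "8 * (m + 4) \<le> n" using n1 unfolding M_def by linarith
  have n3: "Suc (n - 3) = n - 2" "3 \<le> n" using n1 M by linarith+
  define a where "a = real n / 2"
  have a: "0 \<le> a" "a \<le> real (n - 3) - Suc m" "a \<le> real (n - 3) - m" "a \<le> real (Suc (n - 3))"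
    unfolding a_def using n1 n3 M by (auto simp: M_def of_nat_diff)
  have c1: "a / M * ((n - 3) choose m) \<le> (n - 3) choose Suc m"
    using a by (intro binomial_step_ge) (auto simp: M_def)
  have c2: "a / M * ((n - 3) choose Suc m) \<le> (n - 3) choose Suc (Suc m)"
    using a by (intro binomial_step_ge) (auto simp: M_def)
  have m2: "m + 2 = Suc (Suc m)" "m + 3 = Suc (Suc (Suc m))" by simp_all
  have d1: "a / M * ((n - 3) choose Suc m) \<le> (n - 2) choose (m + 2)"
    unfolding m2 n3(1)[symmetric] using a by (intro binomial_Suc_step_ge) (auto simp: M_def)
  have d2: "a / M * ((n - 3) choose Suc (Suc m)) \<le> (n - 2) choose (m + 3)"
    unfolding m2 n3(1)[symmetric] using a by (intro binomial_Suc_step_ge) (auto simp: M_def)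
  have aM: "0 \<le> a / M" using a M by simp
  have "4 * real n \<le> a / M * (a / M)"
  proof -
    have "16 * M\<^sup>2 * n \<le> real n * n" using n2 by (intro mult_right_mono) auto
    then show ?thesis using M by (simp add: a_def field_simps power2_eq_square)
  qed
  then have "4 * real n * ((n - 3) choose m) \<le> a / M * (a / M) * ((n - 3) choose m)"
    by (intro mult_right_mono) auto
  also have "\<dots> \<le> a / M * ((n - 3) choose Suc m)"
    unfolding mult.assoc using c1 aM by (rule mult_left_mono)
  also note d1
  finally show "4 * real n * ((n - 3) choose m) \<le> (n - 2) choose (m + 2)" .
  have "(real n)\<^sup>2 \<le> a / M * (a / M * (a / M))"
  proof -
    have "16 * M ^ 3 * (real n)\<^sup>2 \<le> real n * (real n)\<^sup>2" using n by (intro mult_right_mono) auto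
    moreover have "0 \<le> M ^ 3 * (real n)\<^sup>2" using M by simp
    ultimately have "8 * M ^ 3 * (real n)\<^sup>2 \<le> real n * (real n)\<^sup>2" by linarith
    then show ?thesis using M by (simp add: a_def field_simps power2_eq_square power3_eq_cube)
  qed
  then have "(real n)\<^sup>2 * ((n - 3) choose m) \<le> a / M * (a / M * (a / M)) * ((n - 3) choose m)"
    by (intro mult_right_mono) auto
  also have "\<dots> = a / M * (a / M * (a / M * ((n - 3) choose m)))" by (simp only: mult.assoc)
  also have "\<dots> \<le> a / M * (a / M * ((n - 3) choose Suc m))"
    using c1 aM by (intro mult_left_mono)
  also have "\<dots> \<le> a / M * ((n - 3) choose Suc (Suc m))"
    using c2 aM by (intro mult_left_mono)
  also note d2
  finally show "(real n)\<^sup>2 * ((n - 3) choose m) \<le> (n - 2) choose (m + 3)" .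
qed

text \<open>At level \<open>m + 1\<close> Pascal's rule absorbs the new sets by raising the argument
  from \<open>N\<close> to \<open>N + 1\<close>; at level \<open>m + 2\<close> they stay a separate
  summand. Part (2) takes \<open>N = n - 3\<close>, part (1) takes \<open>N = n - 2\<close>.\<close>

lemma card_blocked_two_steps:
  assumes "finite V" "finite C" "0 < m" "m \<le> N"
    and "\<And>X. X \<in> C \<Longrightarrow> m \<le> card X" "\<And>i. card {X \<in> C. card X = i} \<le> N choose m"
  shows "card (blocked V C m) \<le> N choose m"
    and "card (blocked V C (Suc m)) \<le> Suc N choose Suc m"
    and "card (blocked V C (m + 2)) \<le> (Suc N choose (m + 2)) + (N choose m)"
proof -
  have "card (blocked V C m) \<le> card {X \<in> C. card X = m}"
    using assms by (intro card_mono blocked_first) auto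
  then show "card (blocked V C m) \<le> N choose m" using assms(6)[of m] by linarith
  then have "real (card (blocked V C m)) \<le> real N gchoose m"
    by (simp add: binomial_gbinomial[symmetric])
  then have "real (card (blocked V C (Suc m))) \<le> (real N gchoose Suc m) + card {X \<in> C. card X = Suc m}"
    using assms by (intro card_blocked_grow) auto
  also have "\<dots> = real ((N choose Suc m) + card {X \<in> C. card X = Suc m})"
    by (simp add: binomial_gbinomial)
  finally show b1: "card (blocked V C (Suc m)) \<le> Suc N choose Suc m"
    unfolding of_nat_le_iff using assms(6)[of "Suc m"] by simp
  then have "real (card (blocked V C (Suc m))) \<le> real (Suc N) gchoose Suc m"
    by (simp only: binomial_gbinomial[symmetric] of_nat_le_iff)
  then have "real (card (blocked V C (Suc (Suc m)))) \<le>
      (real (Suc N) gchoose Suc (Suc m)) + card {X \<in> C. card X = Suc (Suc m)}"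
    using assms by (intro card_blocked_grow) auto
  also have "\<dots> = real ((Suc N choose Suc (Suc m)) + card {X \<in> C. card X = Suc (Suc m)})"
    by (simp only: binomial_gbinomial of_nat_add)
  finally show "card (blocked V C (m + 2)) \<le> (Suc N choose (m + 2)) + (N choose m)"
    unfolding of_nat_le_iff using assms(6)[of "Suc (Suc m)"] by simp
qed

text \<open>The argument is \<open>n - 2\<close> at level \<open>m + 1\<close> and may rise to
  \<open>n - 1\<close>. Level \<open>m + 2\<close> costs \<open>1/4\<close>, the later levels
  together at most \<open>1/2\<close>, and the last \<open>1/4\<close> gives strictness.\<close>

lemma card_blocked_less:
  fixes n m t :: nat
  assumes "finite V" "finite C" "0 < m" "16 * (m + 4) ^ 3 \<le> n"
    and "\<And>X. X \<in> C \<Longrightarrow> m \<le> card X" "\<And>i. card {X \<in> C. card X = i} \<le> (n - 3) choose m"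
    and "m + 2 \<le> t" "2 * t \<le> n + 1"
  shows "card (blocked V C t) < (n - 1) choose t"
proof -
  define k where "k = (n - 3) choose m"
  \<comment> \<open>The \<open>k\<close> sets of each new level are absorbed by raising the upper argument by \<open>1/n\<close>,
      which over at most \<open>n/2\<close> levels keeps it below \<open>n - 1\<close>.\<close>
  define x where "x i = real n - 7/4 + (real i - m - 2) / n" for i
  note large = binomial_large[OF assms(4)]
  have n: "32 \<le> n" "8 * m + 32 \<le> n" using large(3) by auto
  have k1: "4 * real n * k \<le> (n - 2) choose (m + 2)" and k2: "(real n)\<^sup>2 * k \<le> (n - 2) choose (m + 3)"
    using large by (simp_all add: k_def)
  have x_ge: "real (n - 2) \<le> x i" if "m + 2 \<le> i" for i
  proof -
    have "0 \<le> (real i - m - 2) / n" using that by (intro divide_nonneg_nonneg) auto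
    then show ?thesis using n by (simp add: x_def of_nat_diff)
  qed
  have x_le: "x i \<le> real n - 5/4" if "2 * i \<le> n + 1" for i
  proof -
    have "(real i - m - 2) / n \<le> 1/2" using that n by (simp add: field_simps)
    then show ?thesis unfolding x_def by linarith
  qed
  have bound: "card (blocked V C i) \<le> x i gchoose i" if "m + 2 \<le> i" "2 * i \<le> n + 1" for i
    using that
  proof (induction i rule: dec_induct)
    case base
    have n32: "Suc (n - 3) = n - 2" using n by simp
    have "card (blocked V C (m + 2)) \<le> ((n - 2) choose (m + 2)) + k"
      using card_blocked_two_steps(3)[of V C m "n - 3"] assms n n32 by (simp add: k_def)
    then have "real (card (blocked V C (m + 2))) \<le> real ((n - 2) choose (m + 2)) + k"
      by linarith
    \<comment> \<open>This is the form in which \<open>gbinomial_growth\<close> with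
      \<open>e = 1/4\<close> absorbs the \<open>k\<close> sets.\<close>
    also have "real k \<le> (1/4) / real (n - 2) * ((n - 2) choose (m + 2))"
    proof -
      have "4 * real (n - 2) * k \<le> 4 * real n * k" by (intro mult_right_mono) auto
      then have "4 * real (n - 2) * k \<le> (n - 2) choose (m + 2)" using k1 by linarith
      then show ?thesis using n by (simp add: field_simps)
    qed
    also have "((n - 2) choose (m + 2)) + (1/4) / real (n - 2) * ((n - 2) choose (m + 2))
        = (1 + (1/4) / real (n - 2)) * (real (n - 2) gchoose (m + 2))"
      by (simp add: binomial_gbinomial algebra_simps)
    also have "\<dots> \<le> (real (n - 2) + 1/4) gchoose (m + 2)"
      using n by (intro gbinomial_growth) auto
    also have "real (n - 2) + 1/4 = x (m + 2)" using n by (simp add: x_def of_nat_diff)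
    finally show ?case by simp
  next
    case (step i)
    have xi: "real (n - 2) \<le> x i" "x i \<le> n" using x_ge[of i] x_le[of i] step by auto
    have x0: "0 < x i" using xi n by simp
    have i2: "Suc i \<le> n - 2" "real (Suc i) \<le> real (n - 2)" using step n by auto
    have "real (card (blocked V C (Suc i))) \<le> (x i gchoose Suc i) + card {X \<in> C. card X = Suc i}"
      using step assms xi i2 by (intro card_blocked_grow) auto
    also have "real (card {X \<in> C. card X = Suc i}) \<le> k" using assms(6) by (simp add: k_def)
    also have "real k \<le> (1/n) / x i * (x i gchoose Suc i)"
    proof -
      \<comment> \<open>Unimodality: \<open>Suc i\<close> lies between \<open>m + 3\<close> and its
        mirror image \<open>n - 2 - (m + 3)\<close>.\<close>
      have "(n - 2) choose (m + 3) \<le> (n - 2) choose Suc i"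
      proof (cases "2 * Suc i \<le> n - 2")
        case True
        then show ?thesis using step by (intro binomial_mono) auto
      next
        case False
        have "(n - 2) choose (m + 3) = (n - 2) choose (n - 2 - (m + 3))"
          using n by (intro binomial_symmetric) auto
        also have "\<dots> \<le> (n - 2) choose Suc i"
          using False step n by (intro binomial_antimono) auto
        finally show ?thesis .
      qed
      then have "real ((n - 2) choose (m + 3)) \<le> real (n - 2) gchoose Suc i"
        by (simp only: binomial_gbinomial[symmetric] of_nat_le_iff)
      also have "\<dots> \<le> x i gchoose Suc i" using xi i2 by (intro gbinomial_mono_real) auto
      finally have "(real n)\<^sup>2 * k \<le> x i gchoose Suc i" using k2 by linarith
      moreover have "n * x i * k \<le> (real n)\<^sup>2 * k"
        unfolding power2_eq_square using xi by (intro mult_right_mono mult_left_mono) auto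
      ultimately have "n * x i * k \<le> x i gchoose Suc i" by linarith
      then show ?thesis using x0 n by (simp add: field_simps)
    qed
    also have "(x i gchoose Suc i) + (1/n) / x i * (x i gchoose Suc i) = (1 + (1/n) / x i) * (x i gchoose Suc i)"
      by (simp add: algebra_simps)
    also have "\<dots> \<le> (x i + 1/n) gchoose Suc i"
      using x0 xi i2 by (intro gbinomial_growth) auto
    also have "x i + 1/n = x (Suc i)" using n by (simp add: x_def field_simps)
    finally show ?case by simp
  qed
  have xt: "real (n - 2) \<le> x t" "x t \<le> real n - 5/4" using x_ge x_le assms by auto
  have t: "real t \<le> real (n - 2)" using assms n by simp
  have x0: "0 < x t" using xt n by simp
  have "real (card (blocked V C t)) \<le> x t gchoose t" using bound assms by blast
  also have "\<dots> < (1 + (1/4) / x t) * (x t gchoose t)"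
    using x0 gbinomial_pos_real[of t "x t"] xt t by simp
  also have "\<dots> \<le> (x t + 1/4) gchoose t"
    using x0 xt t assms by (intro gbinomial_growth) auto
  also have "\<dots> \<le> real (n - 1) gchoose t"
    using xt t n by (intro gbinomial_mono_real) (auto simp: of_nat_diff)
  finally show ?thesis by (simp only: binomial_gbinomial[symmetric] of_nat_less_iff)
qed

section \<open>Complementation and the lower bound in part (2)\<close>

lemma uniform_cutset_level_le:
  assumes "uniform_cutset n m l k C"
  shows "card {X \<in> C. card X = i} \<le> k"
proof (cases "i \<in> {m..l}")
  case False
  then have "{X \<in> C. card X = i} = {}" using assms by (auto simp: uniform_cutset_def)
  then show ?thesis by (simp only: card.empty)
qed (use assms in \<open>auto simp: uniform_cutset_def\<close>)

lemma card_complement: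
  assumes "Y \<subseteq> {1..n :: nat}"
  shows "card ({1..n} - Y) = n - card Y" "card Y \<le> n"
proof -
  have "finite Y" using assms by (rule finite_subset) simp
  then show "card ({1..n} - Y) = n - card Y" using assms by (simp add: card_Diff_subset)
  show "card Y \<le> n" using card_mono[OF _ assms] by simp
qed

lemma card_complement_level_le:
  assumes "C \<subseteq> Pow {1..n :: nat}"
  shows "card {X \<in> (\<lambda>Y. {1..n} - Y) ` C. card X = i} \<le> card {X \<in> C. card X = n - i}"
proof -
  have "finite C" using assms by (rule finite_subset) simp
  moreover have "{X \<in> (\<lambda>Y. {1..n} - Y) ` C. card X = i} \<subseteq>
      (\<lambda>Y. {1..n} - Y) ` {X \<in> C. card X = n - i}"
  proof
    fix X assume "X \<in> {X \<in> (\<lambda>Y. {1..n} - Y) ` C. card X = i}"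
    then obtain Y where Y: "Y \<in> C" "X = {1..n} - Y" "card X = i" by blast
    then have "Y \<subseteq> {1..n}" using assms by blast
    then have "card Y = n - i" using card_complement[of Y n] Y by simp
    then show "X \<in> (\<lambda>Y. {1..n} - Y) ` {X \<in> C. card X = n - i}" using Y by blast
  qed
  ultimately show ?thesis by (intro surj_card_le) auto
qed

text \<open>Complementation maps the levels \<open>m\<close> to \<open>n - m\<close> onto
  themselves, so the same estimate holds from below and from above.\<close>

lemma uniform_cutset_size_gt_symmetric:
  assumes "0 < m" "16 * (m + 4) ^ 3 \<le> n" "uniform_cutset n m (n - m) k C"
  shows "(n - 3) choose m < k"
proof (rule ccontr)
  assume "\<not> ?thesis"
  then have k: "k \<le> (n - 3) choose m" by simp
  define D where "D = (\<lambda>Y. {1..n} - Y) ` C"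
  \<comment> \<open>For odd \<open>n\<close> the complementary level is
    \<open>n - t = (n + 1) / 2\<close>, just within the condition \<open>2 * t \<le> n + 1\<close>
    of \<open>card_blocked_less\<close>.\<close>
  define t where "t = n div 2"
  have n: "8 * (m + 4) \<le> n" using binomial_large(3)[OF assms(2)] .
  have C: "cutset n C" "C \<subseteq> Pow {1..n}" "\<And>X. X \<in> C \<Longrightarrow> m \<le> card X \<and> card X \<le> n - m"
    using assms(3) by (auto simp: uniform_cutset_def cutset_def)
  have fin: "finite C" using C(2) by (rule finite_subset) simp
  have lev: "card {X \<in> C. card X = i} \<le> (n - 3) choose m" for i
    using uniform_cutset_level_le[OF assms(3)] k le_trans by blast
  have "card (blocked {1..n} C t) < (n - 1) choose t"
    using assms fin C lev n by (intro card_blocked_less) (auto simp: t_def)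
  moreover have "card (blocked {1..n} D (n - t)) < (n - 1) choose (n - t)"
  proof (rule card_blocked_less[OF _ _ assms(1,2)])
    show "m \<le> card X" if X: "X \<in> D" for X
    proof -
      obtain Y where Y: "X = {1..n} - Y" "Y \<in> C" using X unfolding D_def by blast
      then have "Y \<subseteq> {1..n}" "card Y \<le> n - m" using C by blast+
      then show ?thesis using card_complement Y n by simp
    qed
    show "card {X \<in> D. card X = i} \<le> (n - 3) choose m" for i
      unfolding D_def using card_complement_level_le[OF C(2)] lev le_trans by blast
  qed (use fin n in \<open>auto simp: D_def t_def\<close>)
  \<comment> \<open>By symmetry and Pascal's rule the two strict bounds add up to less than
    \<open>n choose t\<close>.\<close>
  moreover have "(n - 1) choose (n - t) = (n - 1) choose (t - 1)"
    using n by (subst binomial_symmetric) (auto simp: t_def)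
  moreover have "n choose t = ((n - 1) choose t) + ((n - 1) choose (t - 1))"
    using n choose_reduce_nat[of n t] by (auto simp: t_def)
  moreover have "n choose t \<le> card (blocked {1..n} C t) + card (blocked {1..n} D (n - t))"
    unfolding D_def using C(1) by (rule cutset_card_blocked) (simp add: t_def)
  ultimately show False by linarith
qed

section \<open>The lower bound in part (1), by densities\<close>

text \<open>The main terms are \<open>1 - (m + 2) / n\<close> and at most
  \<open>(m + 1) / n\<close>, leaving a gap of \<open>1 / n\<close>. The other terms, three times
  \<open>b / (n choose (m + 2))\<close> and \<open>n\<close> times
  \<open>b / (n choose (m + 3))\<close>, are of order \<open>1 / n^2\<close> for fixed
  \<open>m\<close>.\<close>

lemma binomial_density_small:
  fixes n m :: nat
  assumes "16 * (m + 4) ^ 3 \<le> n"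
  defines "b \<equiv> real ((n - 2) choose m)"
  shows "(real ((n - 1) choose (m + 2)) + b) / (n choose (m + 2)) + b / (n choose (m + 1)) +
    2 * b / (n choose (m + 2)) + n * (b / (n choose (m + 3))) < 1"
proof -
  define M where "M = real (m + 4)"
  \<comment> \<open>A lower bound for the ratios of successive coefficients: numerators are at least
    \<open>n / 2\<close>, denominators at most \<open>M\<close>.\<close>
  define p where "p = real n / 2 / M"
  define c where "c i = real (n choose (m + i))" for i
  have M: "4 \<le> M" by (simp add: M_def)
  have n8: "8 * (m + 4) \<le> n" using binomial_large(3)[OF assms(1)] .
  have n: "16 * M ^ 3 \<le> n"
    unfolding M_def using assms by (metis of_nat_le_iff of_nat_mult of_nat_numeral of_nat_power)
  have n0: "0 < real n" using n8 by simp
  have S: "Suc (n - 2) = n - 1" "Suc (n - 1) = n" using n8 by auto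
  have p0: "0 < p" using n0 M by (simp add: p_def)
  have cpos: "0 < c i" if "i \<le> 3" for i using n8 that by (simp add: c_def)
  have s1: "p * b \<le> (n - 1) choose (m + 1)"
    using binomial_Suc_step_ge[of m M "real n / 2" "n - 2"] n8
    unfolding S by (simp add: M_def p_def b_def)
  have s2: "p * ((n - 1) choose (m + 1)) \<le> c 2"
    using binomial_Suc_step_ge[of "Suc m" M "real n / 2" "n - 1"] n8
    unfolding S by (simp add: M_def p_def c_def)
  have m3: "m + 3 = Suc (m + 2)" by simp
  have s3: "p * c 2 \<le> c 3"
    unfolding c_def p_def m3 using n8 by (intro binomial_step_ge) (auto simp: M_def)
  have c2: "p\<^sup>2 * b \<le> c 2"
    using s2 mult_left_mono[OF s1, of p] p0 unfolding power2_eq_square mult.assoc by linarith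
  have c3: "p ^ 3 * b \<le> c 3"
    using s3 mult_left_mono[OF c2, of p] p0
    unfolding power2_eq_square power3_eq_cube mult.assoc by linarith
  have d1: "b / c 1 \<le> (m + 1) / n"
  proof -
    have "real n * b \<le> real n * ((n - 1) choose m)"
      unfolding b_def by (intro mult_left_mono) (auto intro!: binomial_right_mono)
    also have "\<dots> = real (m + 1) * c 1"
      using Suc_times_binomial[of m "n - 1"] unfolding S c_def
      by (metis of_nat_mult Suc_eq_plus1)
    finally show ?thesis using n0 cpos[of 1] by (simp add: field_simps)
  qed
  have d2: "b / c 2 \<le> 1 / p\<^sup>2" using c2 cpos[of 2] p0 by (simp add: field_simps)
  have d3: "b / c 3 \<le> 1 / p ^ 3" using c3 cpos[of 3] p0 by (simp add: field_simps)
  have e: "real ((n - 1) choose (m + 2)) / c 2 = 1 - (m + 2) / n"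
  proof -
    have "c 2 = real ((n - 1) choose (m + 2)) + ((n - 1) choose (m + 1))"
      using binomial_Suc_Suc[of "n - 1" "m + 1"] unfolding S by (simp add: c_def)
    moreover have "real n * ((n - 1) choose (m + 1)) = real (m + 2) * c 2"
      using Suc_times_binomial[of "m + 1" "n - 1"] unfolding S c_def
      by (metis of_nat_mult add_2_eq_Suc' Suc_eq_plus1)
    ultimately have "n * real ((n - 1) choose (m + 2)) = (real n - (m + 2)) * c 2"
      by (simp add: algebra_simps)
    then show ?thesis using n0 cpos[of 2] by (simp add: field_simps)
  qed
  have "3 / p\<^sup>2 + n * (1 / p ^ 3) = (12 * M\<^sup>2 + 8 * M ^ 3) / (real n)\<^sup>2"
    using n0 M by (simp add: p_def field_simps power2_eq_square power3_eq_cube)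
  also have "\<dots> < 1 / n"
  proof -
    \<comment> \<open>From \<open>4 \<le> M\<close> the sum is at most \<open>11 M^3\<close>, which
      is below \<open>16 M^3 \<le> n\<close>.\<close>
    have "M\<^sup>2 * 4 \<le> M\<^sup>2 * M" using M by (intro mult_left_mono) auto
    moreover have "0 < M ^ 3" using M by simp
    ultimately have "12 * M\<^sup>2 + 8 * M ^ 3 < n"
      using n by (simp add: power2_eq_square power3_eq_cube)
    then have "(12 * M\<^sup>2 + 8 * M ^ 3) / n < 1" using n0 by simp
    from divide_strict_right_mono[OF this n0] show ?thesis by (simp add: power2_eq_square)
  qed
  finally have small: "3 / p\<^sup>2 + n * (1 / p ^ 3) < 1 / n" .
  have "(real ((n - 1) choose (m + 2)) + b) / c 2 + b / c 1 + 2 * b / c 2 + n * (b / c 3)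
      = real ((n - 1) choose (m + 2)) / c 2 + b / c 1 + 3 * (b / c 2) + n * (b / c 3)"
    by (simp add: add_divide_distrib)
  also have "\<dots> \<le> (1 - (m + 2) / n) + (m + 1) / n + 3 * (1 / p\<^sup>2) + n * (1 / p ^ 3)"
    unfolding e using d1 d2 d3 by (intro add_mono mult_left_mono) auto
  also have "\<dots> = 1 - 1 / n + (3 / p\<^sup>2 + n * (1 / p ^ 3))"
    using n0 by (simp add: field_simps)
  also have "\<dots> < 1" using small by linarith
  finally show ?thesis by (simp add: c_def)
qed

text \<open>From below, three levels suffice to reach \<open>m + 2\<close>. From above, densities
  are accumulated up to the complementary level \<open>n - m - 2\<close>.\<close>

lemma uniform_cutset_size_gt:
  assumes "0 < m" "16 * (m + 4) ^ 3 \<le> n" "l \<le> n - m - 1" "uniform_cutset n m l k C"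
  shows "(n - 2) choose m < k"
proof (rule ccontr)
  assume "\<not> ?thesis"
  then have k: "k \<le> (n - 2) choose m" by simp
  define D where "D = (\<lambda>Y. {1..n} - Y) ` C"
  define b where "b = real ((n - 2) choose m)"
  define q where "q j = card (blocked {1..n} D j) / (n choose j)" for j
  have n: "8 * (m + 4) \<le> n" using binomial_large(3)[OF assms(2)] .
  have C: "cutset n C" "C \<subseteq> Pow {1..n}" "\<And>X. X \<in> C \<Longrightarrow> m \<le> card X \<and> card X \<le> l"
    using assms(4) by (auto simp: uniform_cutset_def cutset_def)
  have fin: "finite C" using C(2) by (rule finite_subset) simp
  have lev: "card {X \<in> C. card X = i} \<le> (n - 2) choose m" for i
    using uniform_cutset_level_le[OF assms(4)] k le_trans by blast
  have levD: "real (card {X \<in> D. card X = i}) \<le> b" for i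
    using card_complement_level_le[OF C(2), of i] lev[of "n - i"] by (simp add: D_def b_def)
  \<comment> \<open>Here \<open>l \<le> n - m - 1\<close> enters: seen from above the cutset starts
    at level \<open>m + 1\<close>, so the initial density is at most
    \<open>b / (n choose (m + 1))\<close>.\<close>
  have Dge: "m + 1 \<le> card X" if X: "X \<in> D" for X
  proof -
    obtain Y where Y: "X = {1..n} - Y" "Y \<in> C" using X unfolding D_def by blast
    then have "Y \<subseteq> {1..n}" "card Y \<le> n - m - 1" using C assms(3) le_trans by blast+
    then show ?thesis using card_complement Y n by simp
  qed
  have S: "Suc (n - 2) = n - 1" using n by simp
  have low: "card (blocked {1..n} C (m + 2)) \<le> ((n - 1) choose (m + 2)) + ((n - 2) choose m)"
    using card_blocked_two_steps(3)[of "{1..n}" C m "n - 2"] assms fin C lev n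
    unfolding S by auto
  have q_Suc: "q (Suc j) \<le> q j + b / (n choose Suc j)" if "0 < j" "j < n" for j
  proof -
    have "q (Suc j) \<le> q j + card {X \<in> D. card X = Suc j} / (n choose Suc j)"
      unfolding q_def using card_blocked_density[of "{1..n}" D j] fin that by (simp add: D_def)
    also have "\<dots> \<le> q j + b / (n choose Suc j)"
      using levD by (intro add_left_mono divide_right_mono) auto
    finally show ?thesis .
  qed
  have q1: "q (m + 1) \<le> b / (n choose (m + 1))"
  proof -
    have "card (blocked {1..n} D (m + 1)) \<le> card {X \<in> D. card X = m + 1}"
      using Dge fin by (intro card_mono blocked_first) (auto simp: D_def)
    then have "real (card (blocked {1..n} D (m + 1))) \<le> b" using levD[of "m + 1"] by linarith
    then show ?thesis unfolding q_def by (rule divide_right_mono) simp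
  qed
  \<comment> \<open>By unimodality each level from \<open>m + 3\<close> to \<open>n - m - 3\<close>
    adds at most \<open>b / (n choose (m + 3))\<close>; the number of these levels is later replaced
    by \<open>n\<close>.\<close>
  have q: "q j \<le> b / (n choose (m + 1)) + b / (n choose (m + 2)) +
      (real j - (m + 2)) * (b / (n choose (m + 3)))"
    if "m + 2 \<le> j" "j \<le> n - m - 3" for j
    using that
  proof (induction j rule: dec_induct)
    case base
    then show ?case using q1 q_Suc[of "m + 1"] n by simp
  next
    case (step j)
    have "(n choose (m + 3)) \<le> n choose Suc j"
    proof (cases "2 * Suc j \<le> n")
      case True
      then show ?thesis using step by (intro binomial_mono) auto
    next
      case False
      have "n choose (m + 3) = n choose (n - (m + 3))" using n by (intro binomial_symmetric) auto
      also have "\<dots> \<le> n choose Suc j" using False step n by (intro binomial_antimono) auto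
      finally show ?thesis .
    qed
    moreover have "0 < n choose (m + 3)" "0 < n choose Suc j" using n step by simp_all
    ultimately have "b / (n choose Suc j) \<le> b / (n choose (m + 3))"
      by (intro divide_left_mono) (auto simp: b_def)
    moreover have "0 < j" "j < n" "j \<le> n - m - 3" using step by linarith+
    ultimately have "q (Suc j) \<le> b / (n choose (m + 1)) + b / (n choose (m + 2)) +
        (real j - (m + 2)) * (b / (n choose (m + 3))) + b / (n choose (m + 3))"
      using q_Suc[of j] step.IH by linarith
    also have "\<dots> = b / (n choose (m + 1)) + b / (n choose (m + 2)) +
        (real (Suc j) - (m + 2)) * (b / (n choose (m + 3)))"
    proof -
      have "(x - y) * z + z = (1 + x - y) * z" for x y z :: real by (simp add: algebra_simps)
      then show ?thesis unfolding of_nat_Suc by (simp only: add.assoc)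
    qed
    finally show ?case .
  qed
  \<comment> \<open>The last level mirrors \<open>m + 2\<close>, hence the factor 2 in
    \<open>qtop\<close>.\<close>
  have "n choose (n - m - 2) = n choose (m + 2)"
    using n binomial_symmetric[of "m + 2" n] by simp
  then have "q (n - m - 2) \<le> q (n - m - 3) + b / (n choose (m + 2))"
    using q_Suc[of "n - m - 3"] n by (simp add: Suc_diff_Suc numeral_3_eq_3 numeral_2_eq_2)
  also have "q (n - m - 3) \<le> b / (n choose (m + 1)) + b / (n choose (m + 2)) + n * (b / (n choose (m + 3)))"
  proof -
    have "(real (n - m - 3) - (m + 2)) * (b / (n choose (m + 3))) \<le> n * (b / (n choose (m + 3)))"
      by (intro mult_right_mono) (auto simp: b_def)
    moreover have "m + 2 \<le> n - m - 3" using n by simp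
    ultimately show ?thesis using q[of "n - m - 3"] by linarith
  qed
  finally have qtop: "q (n - m - 2) \<le> b / (n choose (m + 1)) + 2 * b / (n choose (m + 2)) +
      n * (b / (n choose (m + 3)))" by simp
  have "n choose (m + 2) \<le> card (blocked {1..n} C (m + 2)) + card (blocked {1..n} D (n - (m + 2)))"
    unfolding D_def using C(1) by (rule cutset_card_blocked) (use n in simp)
  then have "real (n choose (m + 2)) \<le>
      ((n - 1) choose (m + 2)) + b + card (blocked {1..n} D (n - m - 2))"
    using low by (simp add: b_def)
  then have "1 \<le> (((n - 1) choose (m + 2)) + b + card (blocked {1..n} D (n - m - 2))) / (n choose (m + 2))"
    using n by (subst pos_le_divide_eq) auto
  also have "\<dots> = (real ((n - 1) choose (m + 2)) + b) / (n choose (m + 2)) + q (n - m - 2)"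
    using \<open>n choose (n - m - 2) = n choose (m + 2)\<close> by (simp add: q_def add_divide_distrib)
  finally show False
    using qtop binomial_density_small[OF assms(2)] by (simp add: b_def)
qed

subsection \<open>Upper bounds\<close>

text \<open>Each step of the induction removes two elements, and the \<open>j\<close>-th summand
  counts the \<open>(m - j)\<close>-sets left after \<open>j + 1\<close> removals. Level sizes are
  only bounded, since padding comes later in \<open>g_le\<close>.\<close>

lemma three_level_cutset:
  assumes "finite V" "2 * m + 2 \<le> card V"
  shows "\<exists>C \<subseteq> Pow V. (\<forall>X\<in>C. card X \<in> {m..m + 2}) \<and>
    (\<forall>i. card {X \<in> C. card X = i} \<le> (\<Sum>j = 0..m. (card V - 2 * j - 2) choose (m - j))) \<and>
    (\<forall>X Y Z. X \<subseteq> Y \<and> Y \<subseteq> Z \<and> Z \<subseteq> V \<and> card X = m \<and> card Y = m + 1 \<and> card Z = m + 2 \<longrightarrow>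
      X \<in> C \<or> Y \<in> C \<or> Z \<in> C)"
  using assms
proof (induction m arbitrary: V)
  case 0
  have "card {X \<in> {{} :: 'a set}. card X = i} \<le> 1" for i
    using card_mono[of "{{} :: 'a set}" "{X \<in> {{}}. card X = i}"] by auto
  moreover have "X = {}" if "X \<subseteq> V" "card X = 0" for X
    using that 0 finite_subset by fastforce
  ultimately show ?case
    by (intro exI[of _ "{{}}"] conjI allI impI) (simp_all, blast)
next
  case (Suc m)
  have "\<not> card V \<le> Suc 0" using Suc.prems(2) by linarith
  then obtain a b where ab: "a \<in> V" "b \<in> V" "a \<noteq> b"
    unfolding card_le_Suc0_iff_eq[OF Suc.prems(1)] by blast
  define W where "W = V - {a, b}"
  have W: "finite W" "card W = card V - 2" using Suc.prems ab by (auto simp: W_def card_Diff_subset)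
  have "2 * m + 2 \<le> card W" using Suc.prems(2) W(2) by simp
  from Suc.IH[OF W(1) this]
  obtain C where C': "C \<subseteq> Pow W" "\<forall>X\<in>C. card X \<in> {m..m + 2}"
    "\<forall>i. card {X \<in> C. card X = i} \<le> (\<Sum>j = 0..m. (card W - 2 * j - 2) choose (m - j))"
    "\<forall>X Y Z. X \<subseteq> Y \<and> Y \<subseteq> Z \<and> Z \<subseteq> W \<and> card X = m \<and> card Y = m + 1 \<and> card Z = m + 2 \<longrightarrow>
      X \<in> C \<or> Y \<in> C \<or> Z \<in> C"
    by (elim exE conjE)
  note C = C'(1) C'(2)[rule_format] C'(3)[rule_format] C'(4)[rule_format, OF conjI, OF _ conjI,
    OF _ _ conjI, OF _ _ _ conjI, OF _ _ _ _ conjI]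
  define S where "S = {X. X \<subseteq> W \<and> card X = Suc m}"
  have finC: "finite C" using C(1) W(1) by (meson finite_Pow_iff finite_subset)
  have finS: "finite S" and cardS: "card S = (card V - 2) choose Suc m"
    using n_subsets[OF W(1), of "Suc m"] W by (auto simp: S_def)
  have in_S: "finite X \<and> a \<notin> X \<and> b \<notin> X \<and> X \<subseteq> V \<and> card X = Suc m" if "X \<in> S" for X
    using that W finite_subset by (auto simp: S_def W_def)
  have in_C: "finite X \<and> a \<notin> X \<and> b \<notin> X \<and> X \<subseteq> V" if "X \<in> C" for X
  proof -
    have "X \<subseteq> W" using that C(1) by blast
    then show ?thesis using W(1) finite_subset by (auto simp: W_def)
  qed
  \<comment> \<open>Inserting \<open>b\<close> into the members of \<open>C\<close> serves the
    chains with \<open>b\<close> but not \<open>a\<close> at all three levels, and shifts the levels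
    of \<open>C\<close> up by one.\<close>
  define E where "E = S \<union> insert a ` S \<union> (\<lambda>X. insert a (insert b X)) ` S \<union> insert b ` C"
  \<comment> \<open>A level contains sets from at most one of the three families built on
    \<open>S\<close>; \<open>f i\<close> is the map producing that family, so \<open>S\<close> is
    counted once per level.\<close>
  define f where "f i X = (if i = Suc m then X else if i = Suc (Suc m) then insert a X
    else insert a (insert b X))" for i :: nat and X
  have card_E: "card {X \<in> E. card X = i} \<le> card S + card {X \<in> C. card X = i - 1}" for i
  proof -
    have "{X \<in> E. card X = i} \<subseteq> f i ` S \<union> insert b ` {X \<in> C. card X = i - 1}"
    proof
      fix X assume "X \<in> {X \<in> E. card X = i}"
      then consider "X \<in> S" | Y where "Y \<in> S" "X = insert a Y"
        | Y where "Y \<in> S" "X = insert a (insert b Y)" | Y where "Y \<in> C" "X = insert b Y"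
        by (auto simp: E_def)
      moreover have "card X = i" using \<open>X \<in> {X \<in> E. card X = i}\<close> by simp
      ultimately show "X \<in> f i ` S \<union> insert b ` {X \<in> C. card X = i - 1}"
      proof cases
        case 1
        then have "X = f i X" using in_S \<open>card X = i\<close> by (auto simp: f_def)
        then show ?thesis using 1 by blast
      next
        case (2 Y)
        then have "X = f i Y" using in_S[of Y] \<open>card X = i\<close> by (auto simp: f_def)
        then show ?thesis using 2 by blast
      next
        case (3 Y)
        then have "X = f i Y" using in_S[of Y] ab \<open>card X = i\<close> by (auto simp: f_def)
        then show ?thesis using 3 by blast
      next
        case (4 Y)
        then have "card Y = i - 1" using in_C[of Y] \<open>card X = i\<close> by auto
        then show ?thesis using 4 by blast
      qed
    qed
    then have "card {X \<in> E. card X = i} \<le> card (f i ` S \<union> insert b ` {X \<in> C. card X = i - 1})"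
      using finS finC by (intro card_mono) auto
    also have "\<dots> \<le> card (f i ` S) + card (insert b ` {X \<in> C. card X = i - 1})" by (rule card_Un_le)
    also have "\<dots> \<le> card S + card {X \<in> C. card X = i - 1}"
      using finS finC by (intro add_mono card_image_le) auto
    finally show ?thesis .
  qed
  have sum: "(\<Sum>j = 0..Suc m. (card V - 2 * j - 2) choose (Suc m - j)) =
      card S + (\<Sum>j = 0..m. (card W - 2 * j - 2) choose (m - j))"
    by (subst sum.atLeast0_atMost_Suc_shift) (simp add: cardS W)
  have E1: "E \<subseteq> Pow V"
  proof -
    have "S \<subseteq> Pow V" "C \<subseteq> Pow V" using in_S in_C by blast+
    then show ?thesis using ab unfolding E_def by blast
  qed
  have E2: "card X \<in> {Suc m..Suc m + 2}" if "X \<in> E" for X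
  proof -
    from that consider "X \<in> S" | Y where "Y \<in> S" "X = insert a Y"
      | Y where "Y \<in> S" "X = insert a (insert b Y)" | Y where "Y \<in> C" "X = insert b Y"
      by (auto simp: E_def)
    then show ?thesis
    proof cases
      case 1
      then show ?thesis using in_S by simp
    next
      case (2 Y)
      then show ?thesis using in_S[of Y] by simp
    next
      case (3 Y)
      then show ?thesis using in_S[of Y] ab by simp
    next
      case (4 Y)
      then show ?thesis using in_C[of Y] C(2)[of Y] by simp
    qed
  qed
  have E3: "card {X \<in> E. card X = i} \<le> (\<Sum>j = 0..Suc m. (card V - 2 * j - 2) choose (Suc m - j))" for i
    unfolding sum using card_E[of i] C(3)[of "i - 1"] by linarith
  have E4: "X \<in> E \<or> Y \<in> E \<or> Z \<in> E"
    if XYZ: "X \<subseteq> Y" "Y \<subseteq> Z" "Z \<subseteq> V" "card X = Suc m" "card Y = Suc m + 1" "card Z = Suc m + 2" for X Y Z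
  proof -
    have fin: "finite X" "finite Y" "finite Z"
      using XYZ Suc.prems(1) by (meson finite_subset)+
    \<comment> \<open>Unless \<open>X\<close> misses both elements or \<open>Z\<close> has both, one
      of them is in all three sets and the other in none. The first three cases are met by
      \<open>X\<close>, \<open>Z\<close> and \<open>Y\<close>, the last by recursion.\<close>
    consider "a \<notin> X" "b \<notin> X" | "a \<in> Z" "b \<in> Z" | "a \<in> X" "b \<notin> Z" | "b \<in> X" "a \<notin> Z"
      using XYZ by blast
    then show ?thesis
    proof cases
      case 1
      then have "X \<in> S" using XYZ by (auto simp: S_def W_def)
      then show ?thesis by (simp add: E_def)
    next
      case 2
      then have "card (Z - {a, b}) = Suc m" using XYZ ab fin by (simp add: card_Diff_subset)
      then have "Z - {a, b} \<in> S" using XYZ by (auto simp: S_def W_def)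
      moreover have "Z = insert a (insert b (Z - {a, b}))" using 2 by blast
      ultimately have "Z \<in> E" unfolding E_def by blast
      then show ?thesis by blast
    next
      case 3
      then have "a \<in> Y" "b \<notin> Y" using XYZ by blast+
      then have "card (Y - {a}) = Suc m" using XYZ fin by simp
      then have "Y - {a} \<in> S" using XYZ \<open>b \<notin> Y\<close> by (auto simp: S_def W_def)
      moreover have "Y = insert a (Y - {a})" using \<open>a \<in> Y\<close> by blast
      ultimately have "Y \<in> E" unfolding E_def by blast
      then show ?thesis by blast
    next
      case 4
      then have b: "b \<in> X" "b \<in> Y" "b \<in> Z" using XYZ by blast+
      have "X - {b} \<in> C \<or> Y - {b} \<in> C \<or> Z - {b} \<in> C"
        using XYZ b fin 4 by (intro C(4)) (auto simp: W_def)
      moreover have "insert b (X - {b}) = X" "insert b (Y - {b}) = Y" "insert b (Z - {b}) = Z"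
        using b by blast+
      ultimately show ?thesis unfolding E_def by (metis UnCI imageI)
    qed
  qed
  show ?case
  proof (intro exI[of _ E] conjI allI impI)
    show "\<forall>X\<in>E. card X \<in> {Suc m..Suc m + 2}" using E2 by blast
    fix X Y Z
    assume "X \<subseteq> Y \<and> Y \<subseteq> Z \<and> Z \<subseteq> V \<and> card X = Suc m \<and> card Y = Suc m + 1 \<and> card Z = Suc m + 2"
    then show "X \<in> E \<or> Y \<in> E \<or> Z \<in> E" by (elim conjE) (rule E4)
  qed (rule E1 E3)+
qed

section \<open>From bounded level sizes to bounds on \<open>g\<close>\<close>

text \<open>Enlarging a cutset keeps it a cutset, so each level can be padded to exactly
  \<open>k\<close> sets. There is room because \<open>n choose m\<close> is the smallest coefficient
  between levels \<open>m\<close> and \<open>n - m\<close>.\<close>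

lemma g_le:
  assumes "cutset n C" "\<And>X. X \<in> C \<Longrightarrow> card X \<in> {m..l}"
    and "\<And>i. card {X \<in> C. card X = i} \<le> k" "k \<le> n choose m" "m + l \<le> n"
  shows "g n m l \<le> k"
proof -
  have C: "C \<subseteq> Pow {1..n}" using assms(1) by (simp add: cutset_def)
  have "\<exists>F. {X \<in> C. card X = i} \<subseteq> F \<and> F \<subseteq> {X. X \<subseteq> {1..n} \<and> card X = i} \<and> card F = k"
    if i: "i \<in> {m..l}" for i
  proof -
    have "n choose m \<le> n choose i"
    proof (cases "2 * i \<le> n")
      case True
      then show ?thesis using i by (intro binomial_mono) auto
    next
      case False
      have "n choose m = n choose (n - m)" using assms(5) by (intro binomial_symmetric) auto
      also have "\<dots> \<le> n choose i" using False i assms(5) by (intro binomial_antimono) auto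
      finally show ?thesis .
    qed
    then have "k \<le> card {X. X \<subseteq> {1..n} \<and> card X = i}"
      using assms(4) n_subsets[of "{1..n}" i] by simp
    then show ?thesis
      using exists_subset_between[of "{X \<in> C. card X = i}" k "{X. X \<subseteq> {1..n} \<and> card X = i}"]
        assms(3)[of i] C by auto
  qed
  then have "\<forall>i\<in>{m..l}. \<exists>F. {X \<in> C. card X = i} \<subseteq> F \<and> F \<subseteq> {X. X \<subseteq> {1..n} \<and> card X = i} \<and> card F = k"
    by blast
  from bchoice[OF this] obtain F where "\<forall>i\<in>{m..l}. {X \<in> C. card X = i} \<subseteq> F i \<and>
      F i \<subseteq> {X. X \<subseteq> {1..n} \<and> card X = i} \<and> card (F i) = k" ..
  note F = bspec[OF this]
  define E where "E = (\<Union>i\<in>{m..l}. F i)"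
  have level: "{X \<in> E. card X = i} = F i" if "i \<in> {m..l}" for i
    using F that unfolding E_def by blast
  have "C \<subseteq> E" using F assms(2) unfolding E_def by blast
  moreover have E: "X \<subseteq> {1..n} \<and> card X \<in> {m..l}" if X: "X \<in> E" for X
  proof -
    obtain i where "i \<in> {m..l}" "X \<in> F i" using X unfolding E_def by blast
    then show ?thesis using F[of i] by blast
  qed
  ultimately have "cutset n E" using assms(1) unfolding cutset_def by blast
  then have "uniform_cutset n m l k E"
    unfolding uniform_cutset_def using level F E by simp
  then show ?thesis unfolding g_def by (intro Least_le exI)
qed

text \<open>Termwise comparison with a diagonal sum that collapses to \<open>N choose m\<close>;
  this supplies the room required by \<open>g_le\<close>.\<close>

lemma sum_binomial_le:
  assumes "m < N"
  shows "(\<Sum>j = 0..m. (N - 2 * j - 2) choose (m - j)) \<le> N choose m"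
proof -
  have "(\<Sum>j = 0..m. (N - 2 * j - 2) choose (m - j)) \<le> (\<Sum>j = 0..m. (N - 1 - j) choose (m - j))"
    by (intro sum_mono binomial_right_mono) auto
  also have "\<dots> = N choose m"
    using sum_choose_diagonal[of m "N - 1"] assms by (simp add: atLeast0AtMost)
  finally show ?thesis .
qed

lemma g_upper:
  assumes "m + 2 \<le> l" "l \<le> n - m - 1" "2 * m + 2 \<le> n"
  shows "g n m l \<le> (\<Sum>j = 0..m. (n - 2 * j - 2) choose (m - j))"
proof -
  obtain C where C: "C \<subseteq> Pow {1..n}" "\<forall>X\<in>C. card X \<in> {m..m + 2}"
    "\<And>i. card {X \<in> C. card X = i} \<le> (\<Sum>j = 0..m. (n - 2 * j - 2) choose (m - j))"
    "\<forall>X Y Z. X \<subseteq> Y \<and> Y \<subseteq> Z \<and> Z \<subseteq> {1..n} \<and> card X = m \<and> card Y = m + 1 \<and> card Z = m + 2 \<longrightarrow>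
      X \<in> C \<or> Y \<in> C \<or> Z \<in> C"
    using three_level_cutset[of "{1..n}" m] assms by auto
  show ?thesis
  proof (rule g_le[OF _ _ C(3)])
    show "cutset n C"
      unfolding cutset_def
    proof (intro conjI C(1) allI impI)
      fix M assume "max_chain n M"
      then obtain A where A: "\<forall>i\<le>n. A i \<subseteq> {1..n} \<and> card (A i) = i" "\<forall>i<n. A i \<subset> A (Suc i)"
        "M = A ` {..n}" unfolding max_chain_def by blast
      have "A m \<subseteq> A (m + 1)" "A (m + 1) \<subseteq> A (m + 2)" "A (m + 2) \<subseteq> {1..n}"
        "card (A m) = m" "card (A (m + 1)) = m + 1" "card (A (m + 2)) = m + 2"
        using A(1) A(2)[rule_format, of m] A(2)[rule_format, of "m + 1"] assms by auto
      then have "A m \<in> C \<or> A (m + 1) \<in> C \<or> A (m + 2) \<in> C" using C(4) by blast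
      moreover have "A m \<in> M" "A (m + 1) \<in> M" "A (m + 2) \<in> M" using A(3) assms by auto
      ultimately show "C \<inter> M \<noteq> {}" by blast
    qed
    show "card X \<in> {m..l}" if "X \<in> C" for X using C(2) that assms by fastforce
  qed (use assms sum_binomial_le[of m n] in auto)
qed

lemma g_upper_symmetric:
  assumes "2 * m + 5 \<le> n"
  shows "g n m (n - m) \<le> (\<Sum>j = 0..m. (n - 2 * j - 3) choose (m - j))"
proof -
  let ?c = "\<lambda>Y. {1..n} - Y"
  define k where "k = (\<Sum>j = 0..m. (n - 2 * j - 3) choose (m - j))"
  \<comment> \<open>The construction lives on the \<open>n - 1\<close> elements of
    \<open>{2..n}\<close>, which turns \<open>n - 2 * j - 2\<close> into
    \<open>n - 2 * j - 3\<close>.\<close>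
  have k_eq: "(\<Sum>j = 0..m. (n - 1 - 2 * j - 2) choose (m - j)) = k"
    unfolding k_def by (intro sum.cong) (auto intro!: arg_cong2[where f = binomial])
  have cardV: "card {2..n} = n - 1" by simp
  have "2 * m + 2 \<le> card {2..n}" using assms by simp
  from three_level_cutset[OF finite_atLeastAtMost this]
  obtain C where C': "C \<subseteq> Pow {2..n}" "\<forall>X\<in>C. card X \<in> {m..m + 2}"
    "\<forall>i. card {X \<in> C. card X = i} \<le> k"
    "\<forall>X Y Z. X \<subseteq> Y \<and> Y \<subseteq> Z \<and> Z \<subseteq> {2..n} \<and> card X = m \<and> card Y = m + 1 \<and> card Z = m + 2 \<longrightarrow>
      X \<in> C \<or> Y \<in> C \<or> Z \<in> C"
    unfolding cardV k_eq by (elim exE conjE)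
  note C = C'(1) C'(2)[rule_format] C'(3)[rule_format] C'(4)[rule_format, OF conjI, OF _ conjI,
    OF _ _ conjI, OF _ _ _ conjI, OF _ _ _ _ conjI]
  have C1: "C \<subseteq> Pow {1..n}" using C(1) by fastforce
  have finC: "finite C" using C1 by (rule finite_subset) simp
  define E where "E = C \<union> ?c ` C"
  have compl_range: "card X \<in> {n - m - 2..n - m}" if X: "X \<in> ?c ` C" for X
  proof -
    obtain Y where "X = ?c Y" "Y \<in> C" "Y \<subseteq> {1..n}" using X C1 by blast
    then show ?thesis using card_complement C(2)[of Y] by auto
  qed
  have "g n m (n - m) \<le> k"
  proof (rule g_le)
    show "cutset n E"
      unfolding cutset_def
    proof (intro conjI allI impI)
      show "E \<subseteq> Pow {1..n}" using C1 by (auto simp: E_def)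
      fix M assume "max_chain n M"
      then obtain A where A: "\<forall>i\<le>n. A i \<subseteq> {1..n} \<and> card (A i) = i" "\<forall>i<n. A i \<subset> A (Suc i)"
        "M = A ` {..n}" unfolding max_chain_def by blast
      have mono: "A i \<subseteq> A j" if "i \<le> j" "j \<le> n" for i j
        using that
      proof (induction j rule: dec_induct)
        case (step j)
        then have "A i \<subseteq> A j" "A j \<subset> A (Suc j)" using A(2) by auto
        then show ?case by blast
      qed simp
      have sub2: "X \<subseteq> {2..n}" if "X \<subseteq> {1..n}" "1 \<notin> X" for X
      proof
        fix x assume "x \<in> X"
        then have "x \<in> {1..n}" "x \<noteq> 1" using that by auto
        then show "x \<in> {2..n}" by auto
      qed
      show "E \<inter> M \<noteq> {}"
      \<comment> \<open>Without \<open>1\<close> in \<open>A (m + 2)\<close>, the sets at levels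
        \<open>m\<close> to \<open>m + 2\<close> lie in \<open>{2..n}\<close>. Otherwise
        \<open>1\<close> is also in \<open>A (n - m - 2)\<close>, so the complements of the sets at
        levels \<open>n - m - 2\<close> to \<open>n - m\<close> lie in
        \<open>{2..n}\<close>.\<close>
      proof (cases "1 \<in> A (m + 2)")
        case False
        then have "A (m + 2) \<subseteq> {2..n}" using A(1) assms by (intro sub2) auto
        moreover have "A m \<subseteq> A (m + 1)" "A (m + 1) \<subseteq> A (m + 2)" using mono assms by auto
        moreover have "card (A m) = m" "card (A (m + 1)) = m + 1" "card (A (m + 2)) = m + 2"
          using A(1) assms by auto
        ultimately have "A m \<in> C \<or> A (m + 1) \<in> C \<or> A (m + 2) \<in> C" using C(4) by blast
        moreover have "A m \<in> M" "A (m + 1) \<in> M" "A (m + 2) \<in> M" using A(3) assms by auto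
        ultimately show ?thesis by (auto simp: E_def)
      next
        case True
        define B where "B i = A (n - i)" for i
        have B: "B i \<subseteq> {1..n}" "card (?c (B i)) = i" if "i \<le> m + 2" for i
        proof -
          have "card (B i) = n - i" "B i \<subseteq> {1..n}" using A(1) unfolding B_def by simp_all
          then show "B i \<subseteq> {1..n}" "card (?c (B i)) = i"
            using card_complement[of "B i" n] that assms by simp_all
        qed
        have "m + 2 \<le> n - (m + 2)" using assms by simp
        then have "1 \<in> B (m + 2)" unfolding B_def using True mono diff_le_self by blast
        then have "?c (B (m + 2)) \<subseteq> {2..n}" by (intro sub2) auto
        moreover have "?c (B m) \<subseteq> ?c (B (m + 1))" "?c (B (m + 1)) \<subseteq> ?c (B (m + 2))"
          unfolding B_def by (intro Diff_mono order_refl mono; simp)+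
        ultimately have "?c (B m) \<in> C \<or> ?c (B (m + 1)) \<in> C \<or> ?c (B (m + 2)) \<in> C"
          using C(4) B by simp
        moreover have "?c (?c (B i)) = B i" if "i \<le> m + 2" for i using B(1)[OF that] by blast
        moreover have "B i \<in> M" for i using A(3) by (auto simp: B_def)
        ultimately show ?thesis unfolding E_def
          by (metis (no_types, lifting) IntI Un_iff add_leD1 empty_iff imageI le_add1 nat_add_left_cancel_le
              one_le_numeral order_refl)
      qed
    qed
    show "card X \<in> {m..n - m}" if "X \<in> E" for X
      using that C(2)[of X] compl_range[of X] assms by (auto simp: E_def)
    \<comment> \<open>Since \<open>2 * m + 5 \<le> n\<close>, level \<open>m + 2\<close> is below
      \<open>n - m - 2\<close>, so no level receives sets from both families.\<close>
    show "card {X \<in> E. card X = i} \<le> k" for i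
    proof (cases "i \<le> m + 2")
      case True
      have "card X \<noteq> i" if "X \<in> ?c ` C" for X
        using compl_range[OF that] True assms unfolding atLeastAtMost_iff by linarith
      then have "{X \<in> E. card X = i} = {X \<in> C. card X = i}"
        unfolding E_def by blast
      then show ?thesis using C(3)[of i] by simp
    next
      case False
      have "card X \<noteq> i" if "X \<in> C" for X
        using C(2)[OF that] False unfolding atLeastAtMost_iff by linarith
      then have "{X \<in> E. card X = i} = {X \<in> ?c ` C. card X = i}"
        unfolding E_def by blast
      then show ?thesis
        using card_complement_level_le[OF C1, of i] C(3)[of "n - i"] by simp
    qed
    have "k \<le> (n - 1) choose m" using sum_binomial_le[of m "n - 1"] assms unfolding k_eq by simp
    also have "\<dots> \<le> n choose m" by (intro binomial_right_mono) simp
    finally show "k \<le> n choose m" .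
  qed (use assms in simp)
  then show ?thesis by (simp add: k_def)
qed

lemma g_attained:
  assumes "m \<le> l" "l \<le> n"
  shows "\<exists>C. uniform_cutset n m l (g n m l) C"
  unfolding g_def
  using LeastI_ex[of "\<lambda>k. \<exists>C. uniform_cutset n m l k C"] uniform_cutset_exists[OF assms] .

text \<open>The strict inequalities assume \<open>m > 0\<close> because for \<open>m = 0\<close>
  both sides equal 1, by \<open>g_zero\<close>.\<close>

theorem theorem2:
  fixes m :: nat
  shows "\<exists>n0 :: nat. \<forall>n > n0.
     (\<forall>l \<in> {m + 2..n - m - 1}.
        (m > 0 \<longrightarrow> (n - 2) choose m < g n m l) \<and>
        g n m l \<le> (\<Sum>j = 0..m. (n - 2 * j - 2) choose (m - j))) \<and>
     (m > 0 \<longrightarrow> (n - 3) choose m < g n m (n - m)) \<and>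
     g n m (n - m) \<le> (\<Sum>j = 0..m. (n - 2 * j - 3) choose (m - j))"
\<comment> \<open>The threshold is the hypothesis of \<open>binomial_large\<close> and
  \<open>binomial_density_small\<close>; its consequence \<open>8 * (m + 4) \<le> n\<close> covers
  the size conditions of the upper bounds.\<close>
proof (intro exI[of _ "16 * (m + 4) ^ 3"] allI impI conjI ballI)
  fix n l :: nat
  assume n: "16 * (m + 4) ^ 3 < n"
  then have large: "16 * (m + 4) ^ 3 \<le> n" by simp
  have n8: "8 * (m + 4) \<le> n" by (rule binomial_large(3)[OF large])
  show "g n m (n - m) \<le> (\<Sum>j = 0..m. (n - 2 * j - 3) choose (m - j))"
    using n8 by (intro g_upper_symmetric) simp
  show "(n - 3) choose m < g n m (n - m)" if "0 < m"
  proof -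
    obtain C where "uniform_cutset n m (n - m) (g n m (n - m)) C"
      using g_attained[of m "n - m" n] n8 by fastforce
    then show ?thesis by (rule uniform_cutset_size_gt_symmetric[OF that large])
  qed
  assume l: "l \<in> {m + 2..n - m - 1}"
  show "g n m l \<le> (\<Sum>j = 0..m. (n - 2 * j - 2) choose (m - j))"
    using l n8 by (intro g_upper) auto
  show "(n - 2) choose m < g n m l" if "0 < m"
  proof -
    obtain C where "uniform_cutset n m l (g n m l) C"
    proof -
      have "m \<le> l" "l \<le> n" using l unfolding atLeastAtMost_iff by linarith+
      then show thesis using g_attained that by blast
    qed
    then show ?thesis using l by (intro uniform_cutset_size_gt[OF that large]) auto
  qed
qed

end
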